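(* Let $q$ be an odd prime power and let $L = (\mathcal P, \mathcal B)$ be an ovoidal Laguerre plane of order $q$. Let $\mathcal F \subseteq \mathcal B$ be an intersecting family. Then $|\mathcal F| \leq q^2$. Equality occurs if and only if $\mathcal F$ consists of all circles through a point of $\mathcal P$, i.e. if and only if there is a point $P \in \mathcal P$ with $\mathcal F = \{ c \in \mathcal B : P \in c \}$.
   Context: $\mathrm{PG}(n,q)$ is the projective space of (projective) dimension $n$ over $\mathbb F_q$. An oval in a projective plane $\mathrm{PG}(2,q)$ is a set of $q+1$ points, no three collinear. An oval cone in $\mathrm{PG}(3,q)$ is a set $\mathcal Q = \bigcup_{P \in \mathcal O} \langle R,P \rangle$, where $\mathcal O$ is an oval in some plane $\pi$ of $\mathrm{PG}(3,q)$, $R$ is a point not in $\pi$ (the vertex), and $\langle R,P\rangle$ is the line through $R$ and $P$. The planes of $\mathrm{PG}(3,q)$ meeting $\mathcal Q$ in an oval (the oval planes) are exactly the planes not containing $R$. An ovoidal Laguerre plane of order $q$ is an incidence structure (isomorphic to one) $(\mathcal P,\mathcal B)$ obtained from an oval cone $\mathcal Q$ in $\mathrm{PG}(3,q)$ as follows: $\mathcal P = \mathcal Q \setminus \{R\}$, and the elements of $\mathcal B$, called circles, are the sets $\pi \cap \mathcal Q$ with $\pi$ a plane of $\mathrm{PG}(3,q)$ not containing $R$. A family $\mathcal F \subseteq \mathcal B$ is intersecting if any two of its members have at least one point in common. *)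

theory Defs
  imports "HOL-Analysis.Analysis" "HOL-Number_Theory.Prime_Powers"
begin

(* The k-dimensional projective subspaces of PG(n,q), where 'a has q elements and
   'n has n + 1: linear subspaces of vector-space dimension k + 1. Incidence is inclusion. *)
definition proj_subspaces :: "nat \<Rightarrow> ('a::field ^ 'n) set set" where
  "proj_subspaces k = {U. vec.subspace U \<and> vec.dim U = k + 1}"

abbreviation proj_points :: "('a::field ^ 'n) set set" where
  "proj_points \<equiv> proj_subspaces 0"

abbreviation proj_lines :: "('a::field ^ 'n) set set" where
  "proj_lines \<equiv> proj_subspaces 1"

abbreviation proj_planes :: "('a::field ^ 'n) set set" where
  "proj_planes \<equiv> proj_subspaces 2"

definition points_on :: "('a::field ^ 'n) set \<Rightarrow> ('a ^ 'n) set set" where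
  "points_on U = {P \<in> proj_points. P \<subseteq> U}"

definition line_through :: "('a::field ^ 'n) set \<Rightarrow> ('a ^ 'n) set \<Rightarrow> ('a ^ 'n) set" where
  "line_through P Q = vec.span (P \<union> Q)"

definition proj_collinear :: "('a::field ^ 'n) set set \<Rightarrow> bool" where
  "proj_collinear S \<longleftrightarrow> (\<exists>l\<in>proj_lines. S \<subseteq> points_on l)"

definition oval_in :: "('a::{field,finite} ^ 'n) set \<Rightarrow> ('a ^ 'n) set set \<Rightarrow> bool" where
  "oval_in \<pi> \<O> \<longleftrightarrow> \<O> \<subseteq> points_on \<pi> \<and> card \<O> = CARD('a) + 1 \<and>
     (\<forall>S\<subseteq>\<O>. card S = 3 \<longrightarrow> \<not> proj_collinear S)"

definition oval_cone :: "('a::{field,finite} ^ 4) set \<Rightarrow> ('a ^ 4) set set \<Rightarrow> bool" where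
  "oval_cone R \<Q> \<longleftrightarrow> R \<in> proj_points \<and>
     (\<exists>\<pi>\<in>proj_planes. \<exists>\<O>. oval_in \<pi> \<O> \<and> R \<notin> points_on \<pi> \<and>
        \<Q> = (\<Union>P\<in>\<O>. points_on (line_through R P)))"

definition cone_circles :: "('a::field ^ 4) set \<Rightarrow> ('a ^ 4) set set \<Rightarrow> ('a ^ 4) set set set" where
  "cone_circles R \<Q> = {points_on \<pi> \<inter> \<Q> | \<pi>. \<pi> \<in> proj_planes \<and> R \<notin> points_on \<pi>}"

definition incidence_isomorphic ::
    "'p set \<Rightarrow> 'p set set \<Rightarrow> 'r set \<Rightarrow> 'r set set \<Rightarrow> bool" where
  "incidence_isomorphic \<P> \<B> \<P>' \<B>' \<longleftrightarrow> \<B> \<subseteq> Pow \<P> \<and> \<B>' \<subseteq> Pow \<P>' \<and>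
     (\<exists>f. bij_betw f \<P> \<P>' \<and> (\<lambda>c. f ` c) ` \<B> = \<B>')"

(* The itself argument fixes the field over which PG(3,q) is taken; the points of the
   Laguerre plane may live in an unrelated type 'p. *)
definition ovoidal_laguerre_plane ::
    "'a::{field,finite} itself \<Rightarrow> nat \<Rightarrow> 'p set \<Rightarrow> 'p set set \<Rightarrow> bool" where
  "ovoidal_laguerre_plane _ q \<P> \<B> \<longleftrightarrow> CARD('a) = q \<and>
     (\<exists>(R :: ('a ^ 4) set) \<Q>. oval_cone R \<Q> \<and>
        incidence_isomorphic \<P> \<B> (\<Q> - {R}) (cone_circles R \<Q>))"

definition intersecting_family :: "'p set set \<Rightarrow> bool" where
  "intersecting_family \<F> \<longleftrightarrow> (\<forall>c\<in>\<F>. \<forall>d\<in>\<F>. c \<inter> d \<noteq> {})"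

end

theory Submission
  imports Defs
begin

section \<open>Why the theorem holds\<close>

text \<open>
  Coordinates turn the statement into one about words that agree pairwise somewhere.  Let the oval lie
  in the plane \<open>\<pi>\<close> and let \<open>K\<close> be a set of \<open>q + 1\<close> vectors representing its points in
  coordinates of \<open>\<pi>\<close>; that no three are collinear means that triple products of distinct members are
  nonzero (\<open>arc\<close>).  A plane avoiding the vertex \<open>R = \<langle>r\<rangle>\<close> is the graph of a linear form \<open>m\<close> on \<open>\<pi>\<close>, and it
  meets the generator through \<open>p \<in> K\<close> in the single point \<open>\<langle>p + (m \<cdot> p) r\<rangle>\<close>.  So circles are vectors
  \<open>m\<close>, points are pairs \<open>(p, a)\<close>, incidence is \<open>m \<cdot> p = a\<close>, and two circles meet iff \<open>m \<cdot> p = m' \<cdot> p\<close> for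
  some \<open>p \<in> K\<close> (\<open>ovoidal_laguerre_plane_coordinates\<close>).  An intersecting family becomes a set \<open>F\<close> of
  vectors which pairwise agree on some member of \<open>K\<close>.

  Oddness of \<open>q\<close> is what provides external lines.  Every point \<open>u\<close> off the oval lies on a line
  missing the oval (\<open>ex_external_line\<close>): counting shows that otherwise every line through \<open>u\<close> meets
  the oval exactly once, so that the oval together with \<open>u\<close> is an arc of \<open>q + 2\<close> points, and such arcs
  have an even number of points.

  If \<open>f\<close> is an external line through \<open>u\<close>, then no two distinct members of \<open>F\<close> differ by a multiple of \<open>f\<close>, so each
  affine plane \<open>{y. y \<cdot> u = s}\<close>, being the union of \<open>q\<close> translates of the span of \<open>f\<close>, contains at most \<open>q\<close>
  members of \<open>F\<close>.  Summing over \<open>s\<close> gives \<open>\<bar>F\<bar> \<le> q\<^sup>2\<close>, and if equality holds then all the planes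
  belonging to points \<open>u\<close> off the oval contain exactly \<open>q\<close> members.

  In the case of equality write \<open>n p a\<close> for the number of \<open>y \<in> F\<close> with \<open>y \<cdot> p = a\<close>, where \<open>p \<in> K\<close>.
  Counting the members of \<open>F\<close> on all planes through a vector \<open>x\<close>, and removing the contribution of the
  planes that belong to points off the oval, leaves
  \<open>(\<Sum>p\<in>K. n p (x \<cdot> p)) = q\<^sup>2 (1 + [x \<in> F])\<close>
  (\<open>oval_sections_through\<close>): the indicator function of \<open>F\<close> is a sum of functions of one coordinate each.
  Any three coordinates of \<open>x\<close> are independent.  Summing the identity over a line \<open>x \<cdot> p = a\<close>,
  \<open>x \<cdot> r = b\<close> therefore expresses the number of members of \<open>F\<close> on that line by \<open>n p a + n r b\<close>
  (\<open>line_section\<close>), and summing it over the members of \<open>F\<close> with \<open>x \<cdot> p = a\<close> shows that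
  \<open>(n p a)\<^sup>2 - q\<^sup>2 n p a\<close> does not depend on \<open>a\<close> (\<open>section_quadratic\<close>).  Hence \<open>n p a = n p b\<close> or
  \<open>n p a + n p b = q\<^sup>2\<close> for all \<open>a\<close> and \<open>b\<close>.  If \<open>n p a\<close> were independent of \<open>a\<close> for each \<open>p\<close>, all these numbers
  would equal \<open>q\<close>, in conflict with the identity at a member of \<open>F\<close>.  So \<open>n p a \<noteq> n p b\<close> for some \<open>p\<close>,
  \<open>a\<close>, \<open>b\<close>; these two numbers already add up to \<open>q\<^sup>2 = \<bar>F\<bar>\<close>, hence \<open>n p c = 0\<close> for a third value \<open>c\<close>, and the
  dichotomy for \<open>a\<close> and \<open>c\<close> shows that one of \<open>n p a\<close>, \<open>n p b\<close> is \<open>q\<^sup>2\<close> (\<open>ex_full_section\<close>).  That is, \<open>F\<close>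
  consists of all vectors with a prescribed value on \<open>p\<close>.
\<close>

section \<open>Dot and cross products in dimension three\<close>

abbreviation dot :: "'a::field ^ 'n \<Rightarrow> 'a ^ 'n \<Rightarrow> 'a"  (infixl "\<cdot>" 70)
  where "x \<cdot> y \<equiv> scalar_product x y"

lemma dot_simps:
  fixes x y z :: "'a::field ^ 'n"
  shows "(x + y) \<cdot> z = x \<cdot> z + y \<cdot> z" "(x - y) \<cdot> z = x \<cdot> z - y \<cdot> z" "(c *s x) \<cdot> z = c * (x \<cdot> z)"
    "x \<cdot> (y + z) = x \<cdot> y + x \<cdot> z" "x \<cdot> (y - z) = x \<cdot> y - x \<cdot> z" "x \<cdot> (c *s z) = c * (x \<cdot> z)"
    "0 \<cdot> x = 0" "x \<cdot> 0 = 0"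
  by (simp_all add: scalar_product_def algebra_simps sum.distrib sum_subtractf sum_distrib_left)

lemma dot_commute: "x \<cdot> y = y \<cdot> (x :: 'a::field ^ 'n)"
  by (simp add: scalar_product_def mult.commute)

lemma dot3: "x \<cdot> y = x$1 * y$1 + x$2 * y$2 + x$3 * (y :: 'a::field ^ 3)$3"
  by (simp add: scalar_product_def sum_3)

lemma ex_dot_eq_1:
  fixes d :: "'a::field ^ 'n"
  assumes "d \<noteq> 0"
  shows "\<exists>e. d \<cdot> e = 1"
proof -
  obtain i where i: "d $ i \<noteq> 0"
    using assms by (auto simp: vec_eq_iff)
  have "d \<cdot> axis i (1 / d $ i) = (\<Sum>j\<in>UNIV. if j = i then 1 else 0)"
    unfolding scalar_product_def using i by (intro sum.cong) (auto simp: axis_def)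
  then show ?thesis by auto
qed

text \<open>  Vectors serve both as points of the projective plane and, via the dot product, as its lines: the
  line \<open>f\<close> consists of the points \<open>u\<close> with \<open>f \<cdot> u = 0\<close>.  The cross product is at once the line through two
  points and the intersection of two lines, and it vanishes exactly on proportional vectors.\<close>

definition vcross :: "'a::field ^ 3 \<Rightarrow> 'a ^ 3 \<Rightarrow> 'a ^ 3" where
  "vcross a b = vector [a$2 * b$3 - a$3 * b$2, a$3 * b$1 - a$1 * b$3, a$1 * b$2 - a$2 * b$1]"

lemma vcross_dot:
  "vcross a b \<cdot> a = 0" "vcross a b \<cdot> b = 0"
  by (simp_all add: vcross_def dot3 algebra_simps)

lemma vcross_add_left: "vcross (a + b) c = vcross a c + vcross b c"
  by (simp add: vcross_def vec_eq_iff forall_3 algebra_simps)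

lemma vcross_smult_left: "vcross (k *s a) b = k *s vcross a b"
  by (simp add: vcross_def vec_eq_iff forall_3 algebra_simps)

lemma vcross_self: "vcross a a = 0"
  by (simp add: vcross_def vec_eq_iff forall_3 algebra_simps)

lemma vcross_0_left: "vcross 0 a = 0"
  by (simp add: vcross_def vec_eq_iff forall_3)

lemma vcross_antisym: "vcross a b = - vcross b a"
  by (simp add: vcross_def vec_eq_iff forall_3 algebra_simps)

lemma triple_rotate: "vcross a b \<cdot> c = vcross b c \<cdot> a"
  by (simp add: vcross_def dot3 algebra_simps)

lemma vcross_vcross: "vcross (vcross a b) x = (a \<cdot> x) *s b - (b \<cdot> x) *s a"
  by (simp add: vcross_def dot3 vec_eq_iff forall_3 algebra_simps)

text \<open>  With \<open>a \<cdot> e = 1\<close>, the expansion of \<open>vcross (vcross a b) e\<close> reads \<open>0 = b - (b \<cdot> e) *s a\<close>.\<close>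

lemma parallel_if_vcross_eq_0:
  assumes "a \<noteq> 0" "vcross a b = 0"
  shows "\<exists>c. b = c *s a"
proof -
  obtain e where e: "a \<cdot> e = 1" using ex_dot_eq_1[OF assms(1)] by blast
  have "(a \<cdot> e) *s b - (b \<cdot> e) *s a = 0"
    using vcross_vcross[of a b e] assms(2) by (simp add: vcross_0_left)
  then show ?thesis using e by auto
qed

lemma parallel_vcross_if_orthogonal:
  assumes "vcross a b \<noteq> 0" "x \<cdot> a = 0" "x \<cdot> b = 0"
  shows "\<exists>c. x = c *s vcross a b"
  using assms by (intro parallel_if_vcross_eq_0) (simp_all add: vcross_vcross dot_commute[of _ x])

section \<open>Counting orthogonal vectors\<close>

lemma card_eq_sum_card_fibres:
  fixes \<phi> :: "'b \<Rightarrow> 'c::finite"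
  assumes "finite A"
  shows "card A = (\<Sum>s\<in>UNIV. card {y \<in> A. \<phi> y = s})"
  using sum.group[OF assms finite_class.finite_UNIV, of \<phi> "\<lambda>_. 1::nat"] by simp

lemma card_hyperplane:
  fixes d :: "'a::{field,finite} ^ 3"
  assumes "d \<noteq> 0"
  shows "card {u. d \<cdot> u = s} = CARD('a)\<^sup>2"
proof -
  obtain e where e: "d \<cdot> e = 1" using ex_dot_eq_1[OF assms] by blast
  have eq: "card {u. d \<cdot> u = t} = card {u. d \<cdot> u = s}" for t
    by (rule bij_betw_same_card[of "\<lambda>u. u + (s - t) *s e"],
        rule bij_betw_byWitness[where f' = "\<lambda>u. u - (s - t) *s e"])
      (auto simp: dot_simps e)
  have "CARD('a) ^ 3 = card (UNIV :: ('a ^ 3) set)" by simp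
  also have "\<dots> = (\<Sum>t\<in>UNIV. card {u \<in> UNIV. d \<cdot> u = t})"
    by (rule card_eq_sum_card_fibres) simp
  also have "\<dots> = (\<Sum>t\<in>(UNIV :: 'a set). card {u. d \<cdot> u = s})"
    by (rule sum.cong) (auto intro: eq)
  finally show ?thesis by (simp add: power3_eq_cube power2_eq_square)
qed

lemma card_scalar_multiples:
  fixes d :: "'a::{field,finite} ^ 'n"
  assumes "d \<noteq> 0"
  shows "card (range (\<lambda>c. c *s d)) = CARD('a)"
  using assms by (intro card_image) (auto simp: inj_on_def)

lemma card_orthogonal_pair:
  fixes a b :: "'a::{field,finite} ^ 3"
  assumes "vcross a b \<noteq> 0"
  shows "card {x. x \<cdot> a = 0 \<and> x \<cdot> b = 0} = CARD('a)"
proof -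
  have "{x. x \<cdot> a = 0 \<and> x \<cdot> b = 0} = range (\<lambda>c. c *s vcross a b)"
    using parallel_vcross_if_orthogonal[OF assms] by (auto simp: dot_simps vcross_dot)
  then show ?thesis using card_scalar_multiples[OF assms] by simp
qed

text \<open>  Each of the \<open>q + 1\<close> points of \<open>S\<close> lies on a single line through \<open>u\<close>, that is on \<open>q - 1\<close> nonzero vectors,
  and there are \<open>q\<^sup>2 - 1 = (q + 1) (q - 1)\<close> nonzero vectors orthogonal to \<open>u\<close>.  So the lines through \<open>u\<close>
  contain one point of \<open>S\<close> on average: as soon as all of them contain at most one, or all of them at
  least one, each contains exactly one.\<close>

lemma pencil_count:
  fixes u :: "'a::{field,finite} ^ 3"
  assumes "card S = CARD('a) + 1" and "\<And>p. p \<in> S \<Longrightarrow> vcross u p \<noteq> 0"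
  shows "(\<Sum>f\<in>{f. f \<cdot> u = 0} - {0}. card {p \<in> S. f \<cdot> p = 0}) = (\<Sum>f\<in>{f. f \<cdot> u = 0} - {0}. 1)"
proof -
  let ?N = "{f. f \<cdot> u = 0} - {0}" and ?q = "CARD('a)"
  have q1: "?q \<ge> 1" by simp
  have "u \<noteq> 0"
    using assms by (metis One_nat_def card.empty add_is_0 ex_in_conv one_neq_zero vcross_0_left)
  then have N: "card ?N = ?q\<^sup>2 - 1"
    using card_hyperplane[of u 0] by (simp add: card_Diff_singleton dot_commute[of _ u] dot_simps)
  have L: "card {f \<in> ?N. f \<cdot> p = 0} = ?q - 1" if "p \<in> S" for p
  proof -
    have "{f \<in> ?N. f \<cdot> p = 0} = {f. f \<cdot> u = 0 \<and> f \<cdot> p = 0} - {0}" by auto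
    then show ?thesis using card_orthogonal_pair[OF assms(2)[OF that]]
      by (simp add: card_Diff_singleton dot_simps)
  qed
  have "(\<Sum>f\<in>?N. card {p \<in> S. f \<cdot> p = 0}) = (\<Sum>p\<in>S. card {f \<in> ?N. f \<cdot> p = 0})"
    by (rule sum_multicount_gen[symmetric]) auto
  also have "\<dots> = (?q + 1) * (?q - 1)" using L assms(1) by simp
  also have "\<dots> = card ?N"
    unfolding N using q1 by (cases ?q) (auto simp: power2_eq_square)
  finally show ?thesis by simp
qed

section \<open>Arcs and external lines\<close>

definition arc :: "('a::field ^ 3) set \<Rightarrow> bool" where
  "arc K \<longleftrightarrow> (\<forall>p\<in>K. \<forall>r\<in>K. \<forall>t\<in>K. p \<noteq> r \<longrightarrow> p \<noteq> t \<longrightarrow> r \<noteq> t \<longrightarrow> vcross p r \<cdot> t \<noteq> 0)"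

lemma arcD: "arc K \<Longrightarrow> p \<in> K \<Longrightarrow> r \<in> K \<Longrightarrow> t \<in> K \<Longrightarrow> p \<noteq> r \<Longrightarrow> p \<noteq> t \<Longrightarrow> r \<noteq> t \<Longrightarrow> vcross p r \<cdot> t \<noteq> 0"
  unfolding arc_def by blast

lemma ex_third:
  assumes "card K \<ge> 3" shows "\<exists>t\<in>K. t \<noteq> p \<and> t \<noteq> r"
proof (rule ccontr)
  assume "\<not> ?thesis"
  then have "K \<subseteq> {p, r}" by blast
  then have "card K \<le> card {p, r}" by (intro card_mono) auto
  then show False using assms card_insert_le_m1[of 2 "{r}" p] by simp
qed

lemma arc_vcross_neq_0:
  assumes "arc K" "card K \<ge> 3" "p \<in> K" "r \<in> K" "p \<noteq> r"
  shows "vcross p r \<noteq> 0"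
proof -
  obtain t where "t \<in> K" "t \<noteq> p" "t \<noteq> r" using ex_third[OF assms(2)] by blast
  then have "vcross p r \<cdot> t \<noteq> 0" using arcD assms by metis
  then show ?thesis by (auto simp: dot_simps)
qed

lemma arc_neq_0:
  assumes "arc K" "card K \<ge> 3" "p \<in> K"
  shows "p \<noteq> 0"
proof -
  obtain r where "r \<in> K" "r \<noteq> p" using ex_third[OF assms(2)] by blast
  then have "vcross p r \<noteq> 0" using arc_vcross_neq_0[OF assms] by auto
  then show ?thesis by (auto simp: vcross_0_left)
qed

text \<open>  A linear form is determined by its values on any three points of an arc: the words
  \<open>(d \<cdot> p)\<close>, \<open>p \<in> K\<close>, form a maximum distance separable code of dimension three.\<close>

lemma arc_eq_0_if_three_zeros:
  assumes "arc K" "p \<in> K" "r \<in> K" "t \<in> K" "p \<noteq> r" "p \<noteq> t" "r \<noteq> t"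
    and "d \<cdot> p = 0" "d \<cdot> r = 0" "d \<cdot> t = 0"
  shows "d = 0"
proof -
  have *: "vcross p r \<cdot> t \<noteq> 0" using arcD assms by metis
  then have "vcross p r \<noteq> 0" by (auto simp: dot_simps)
  then obtain c where "d = c *s vcross p r"
    using parallel_vcross_if_orthogonal assms by blast
  then show ?thesis using * assms(10) by (simp add: dot_simps)
qed

text \<open>  The witness is the sum of two members, a third point on a secant.\<close>

lemma ex_off_arc:
  assumes "arc K" "card K \<ge> 3"
  shows "\<exists>u. \<forall>p\<in>K. vcross u p \<noteq> 0"
proof -
  obtain p where p: "p \<in> K" using assms(2) by fastforce
  obtain r where r: "r \<in> K" "r \<noteq> p" using ex_third[OF assms(2)] by blast
  have pr: "vcross p r \<noteq> 0" using arc_vcross_neq_0[OF assms] p r by auto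
  have "vcross (p + r) t \<noteq> 0" if "t \<in> K" for t
  proof
    assume 0: "vcross (p + r) t = 0"
    have "vcross r p \<noteq> 0" using pr vcross_antisym[of r p] by auto
    then have tp: "t \<noteq> p" using 0 by (auto simp: vcross_add_left vcross_self)
    have tr: "t \<noteq> r" using 0 pr by (auto simp: vcross_add_left vcross_self)
    have "p + r \<noteq> 0"
    proof
      assume "p + r = 0"
      then have "vcross (p + r) r = 0" by (simp add: vcross_0_left)
      then show False using pr by (simp add: vcross_add_left vcross_self)
    qed
    then obtain c where c: "t = c *s (p + r)"
      using parallel_if_vcross_eq_0 0 by blast
    have "vcross p r \<cdot> t = 0"
      by (simp add: c dot_simps vcross_dot)
    then show False using arcD[OF assms(1) p r(1) that] r tp tr by auto
  qed
  then show ?thesis by blast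
qed

text \<open>  Every line through a point of \<open>H\<close> contains exactly one further point of \<open>H\<close>.  The lines through a point
  \<open>w\<close> outside \<open>H\<close> therefore split \<open>H\<close> into pairs.\<close>

lemma even_if_hyperoval:
  fixes H :: "('a::{field,finite} ^ 3) set"
  assumes arc: "arc H" and card: "card H = CARD('a) + 2"
  shows "even CARD('a)"
proof -
  let ?q = "CARD('a)"
  have "card {0, 1 :: 'a} \<le> ?q" by (intro card_mono) auto
  then have c3: "card H \<ge> 3" using card by simp
  have secant: "card {r \<in> H - {p}. f \<cdot> r = 0} = 1" if p: "p \<in> H" and f: "f \<cdot> p = 0" "f \<noteq> 0" for f p
  proof -
    have nz: "vcross p r \<noteq> 0" if "r \<in> H - {p}" for r
      using arc_vcross_neq_0[OF arc c3] p that by auto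
    have cH: "card (H - {p}) = ?q + 1" using p card by (simp add: card_Diff_singleton)
    have "card {r \<in> H - {p}. g \<cdot> r = 0} \<le> 1" if "g \<in> {f. f \<cdot> p = 0} - {0}" for g
    proof -
      have "\<forall>r\<in>{r \<in> H - {p}. g \<cdot> r = 0}. \<forall>t\<in>{r \<in> H - {p}. g \<cdot> r = 0}. r = t"
        using arc_eq_0_if_three_zeros[OF arc p, of _ _ g] that by blast
      then show ?thesis by (simp add: card_le_Suc0_iff_eq)
    qed
    from sum_mono_inv[OF pencil_count[OF cH nz] this, of f] f show ?thesis by simp
  qed
  obtain w where w: "\<And>p. p \<in> H \<Longrightarrow> vcross w p \<noteq> 0"
    using ex_off_arc[OF arc c3] by blast
  \<comment> \<open>\<open>L p\<close> is the set of points of \<open>H\<close> on the line joining \<open>w\<close> and \<open>p\<close>.\<close>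
  define L where "L p = {r \<in> H. vcross w p \<cdot> r = 0}" for p
  have L2: "card (L p) = 2" if "p \<in> H" for p
  proof -
    have "L p = insert p {r \<in> H - {p}. vcross w p \<cdot> r = 0}"
      using that by (auto simp: L_def vcross_dot)
    then show ?thesis using secant[OF that, of "vcross w p"] w[OF that] by (simp add: vcross_dot)
  qed
  have Leq: "L p = L r" if "p \<in> H" "r \<in> L p" for p r
  proof -
    have r: "r \<in> H" "vcross w p \<cdot> r = 0" using that by (auto simp: L_def)
    obtain c where c: "vcross w p = c *s vcross w r"
      using parallel_vcross_if_orthogonal[OF w[OF r(1)]] r(2) vcross_dot by blast
    moreover have "c \<noteq> 0" using w[OF that(1)] c by auto
    ultimately show ?thesis by (simp add: L_def dot_simps)
  qed
  have "2 * card (L ` H) = card (\<Union>(L ` H))"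
  proof (rule card_partition)
    fix A B assume "A \<in> L ` H" "B \<in> L ` H" "A \<noteq> B"
    then show "A \<inter> B = {}" using Leq by blast
  qed (auto simp: L2)
  also have "\<Union>(L ` H) = H"
    by (auto simp: L_def vcross_dot)
  finally show ?thesis using card by (metis dvd_triv_left even_add even_numeral)
qed

text \<open>  If all lines through \<open>u\<close> meet the oval, then each meets it once.  So \<open>u\<close> is a nucleus, and adding
  it to the oval gives a hyperoval, which exists only for even \<open>q\<close>.\<close>

lemma ex_external_line:
  fixes K :: "('a::{field,finite} ^ 3) set"
  assumes arc: "arc K" and card: "card K = CARD('a) + 1" and odd: "odd CARD('a)"
    and off: "\<And>p. p \<in> K \<Longrightarrow> vcross u p \<noteq> 0"
  shows "\<exists>f. f \<cdot> u = 0 \<and> (\<forall>p\<in>K. f \<cdot> p \<noteq> 0)"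
proof (rule ccontr)
  assume "\<not> ?thesis"
  then have zero: "\<exists>p\<in>K. f \<cdot> p = 0" if "f \<cdot> u = 0" for f using that by blast
  have ge1: "1 \<le> card {p \<in> K. f \<cdot> p = 0}" if "f \<in> {f. f \<cdot> u = 0} - {0}" for f
    using zero[of f] that by (auto simp: Suc_le_eq card_gt_0_iff)
  have one: "card {p \<in> K. f \<cdot> p = 0} = 1" if "f \<cdot> u = 0" "f \<noteq> 0" for f
    using sum_mono_inv[OF pencil_count[OF card off, symmetric] ge1, of f] that by simp
  have nuc: "vcross u p \<cdot> r \<noteq> 0" if "p \<in> K" "r \<in> K" "p \<noteq> r" for p r
  proof
    assume "vcross u p \<cdot> r = 0"
    then have "card {p, r} \<le> card {t \<in> K. vcross u p \<cdot> t = 0}"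
      using that by (intro card_mono) (auto simp: vcross_dot)
    then show False using one[of "vcross u p"] that off by (auto simp: vcross_dot)
  qed
  have "u \<notin> K" using off vcross_self by blast
  then have "card (insert u K) = CARD('a) + 2" using card by simp
  moreover have "arc (insert u K)"
    unfolding arc_def
  proof (intro ballI impI)
    fix p r t assume *: "p \<in> insert u K" "r \<in> insert u K" "t \<in> insert u K" "p \<noteq> r" "p \<noteq> t" "r \<noteq> t"
    then consider "p = u" "r \<in> K" "t \<in> K" | "r = u" "p \<in> K" "t \<in> K" | "t = u" "p \<in> K" "r \<in> K"
      | "p \<in> K" "r \<in> K" "t \<in> K" by blast
    then show "vcross p r \<cdot> t \<noteq> 0"
    proof cases
      case 1 then show ?thesis using nuc * by auto
    next
      case 2 then show ?thesis using nuc[of t p] * by (simp add: triple_rotate)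
    next
      case 3 then show ?thesis using nuc[of p r] * by (simp add: triple_rotate)
    next
      case 4 then show ?thesis using arcD[OF arc] * by auto
    qed
  qed
  ultimately show False using even_if_hyperoval odd by blast
qed

section \<open>Sets of vectors that agree pairwise on an oval\<close>

locale odd_oval =
  fixes K :: "('a::{field,finite} ^ 3) set"
  assumes arc: "arc K" and card_K: "card K = CARD('a) + 1" and odd_q: "odd CARD('a)"
begin

lemma q_ge_3: "CARD('a) \<ge> 3"
proof -
  have "card {0, 1 :: 'a} \<le> CARD('a)" by (intro card_mono) auto
  then have "CARD('a) \<ge> 2" by simp
  moreover have "CARD('a) \<noteq> 2" using odd_q by auto
  ultimately show ?thesis by simp
qed

lemma card_K_ge_3: "card K \<ge> 3"
  using card_K q_ge_3 by simp

text \<open>  Intersecting families in coordinates: \<open>x\<close> stands for the circle through the points \<open>(p, x \<cdot> p)\<close>.\<close>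

definition pairwise_agreeing :: "('a ^ 3) set \<Rightarrow> bool" where
  "pairwise_agreeing F \<longleftrightarrow> (\<forall>x\<in>F. \<forall>y\<in>F. \<exists>p\<in>K. x \<cdot> p = y \<cdot> p)"

text \<open>  Let \<open>f\<close> be an external line through \<open>u\<close>.  Members of \<open>F\<close> never differ by a nonzero multiple of \<open>f\<close>, because
  \<open>f\<close> vanishes nowhere on \<open>K\<close>.  So \<open>F\<close> has at most one member on each translate of the span of \<open>f\<close>, and
  the plane in question consists of \<open>q\<close> such translates.  A second point \<open>g\<close> of the line \<open>f\<close> tells them
  apart: within the plane, vectors with the same \<open>y \<cdot> g\<close> differ by a multiple of \<open>f\<close>.\<close>

lemma off_oval_section_le:
  assumes agr: "pairwise_agreeing F" and off: "\<And>p. p \<in> K \<Longrightarrow> vcross u p \<noteq> 0"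
  shows "card {y \<in> F. y \<cdot> u = s} \<le> CARD('a)"
proof -
  obtain f where f: "f \<cdot> u = 0" "\<And>p. p \<in> K \<Longrightarrow> f \<cdot> p \<noteq> 0"
    using ex_external_line[OF arc card_K odd_q off] by blast
  obtain p where p: "p \<in> K" using card_K_ge_3 by fastforce
  have u0: "u \<noteq> 0" using off[OF p] by (auto simp: vcross_0_left)
  have f0: "f \<noteq> 0" using f(2)[OF p] by (auto simp: dot_simps)
  \<comment> \<open>The line \<open>f\<close> contains points other than \<open>u\<close>, since \<open>q\<^sup>2 > q\<close>.\<close>
  have "card (range (\<lambda>c. c *s u)) < card {g. f \<cdot> g = 0}"
    using card_scalar_multiples[OF u0] card_hyperplane[OF f0, of 0] q_ge_3
    by (simp add: power2_eq_square)
  then have "\<not> {g. f \<cdot> g = 0} \<subseteq> range (\<lambda>c. c *s u)"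
    using card_mono[of "range (\<lambda>c. c *s u)" "{g. f \<cdot> g = 0}"] by auto
  then obtain g where g: "f \<cdot> g = 0" "\<And>c. g \<noteq> c *s u" by blast
  have ug: "vcross u g \<noteq> 0" using parallel_if_vcross_eq_0[OF u0] g(2) by blast
  obtain k where k: "f = k *s vcross u g"
    using parallel_vcross_if_orthogonal[OF ug] f(1) g(1) by blast
  have "inj_on (\<lambda>y. y \<cdot> g) {y \<in> F. y \<cdot> u = s}"
  proof (rule inj_onI)
    fix x y assume xy: "x \<in> {y \<in> F. y \<cdot> u = s}" "y \<in> {y \<in> F. y \<cdot> u = s}" "x \<cdot> g = y \<cdot> g"
    then obtain c where c: "x - y = c *s vcross u g"
      using parallel_vcross_if_orthogonal[OF ug, of "x - y"] by (auto simp: dot_simps)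
    obtain r where r: "r \<in> K" "x \<cdot> r = y \<cdot> r"
      using agr xy unfolding pairwise_agreeing_def by blast
    have "(x - y) \<cdot> r = 0" using r by (simp add: dot_simps)
    then have "c * (vcross u g \<cdot> r) = 0" by (simp add: c dot_simps)
    moreover have "vcross u g \<cdot> r \<noteq> 0" using f(2)[OF r(1)] by (simp add: k dot_simps)
    ultimately show "x = y" using c by simp
  qed
  then show ?thesis
    using card_inj_on_le[of "\<lambda>y. y \<cdot> g" "{y \<in> F. y \<cdot> u = s}" UNIV] by simp
qed

lemma card_pairwise_agreeing_le:
  assumes agr: "pairwise_agreeing F"
  shows "card F \<le> CARD('a)\<^sup>2"
proof -
  obtain u where off: "\<And>p. p \<in> K \<Longrightarrow> vcross u p \<noteq> 0"
    using ex_off_arc[OF arc card_K_ge_3] by blast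
  have "card F = (\<Sum>s\<in>UNIV. card {y \<in> F. y \<cdot> u = s})"
    by (rule card_eq_sum_card_fibres) simp
  also have "\<dots> \<le> (\<Sum>s\<in>(UNIV :: 'a set). CARD('a))"
    by (intro sum_mono off_oval_section_le[OF agr off])
  finally show ?thesis by (simp add: power2_eq_square)
qed

text \<open>  The \<open>q\<close> parallel planes belonging to \<open>u\<close> partition the \<open>q\<^sup>2\<close> members of \<open>F\<close>, so none of the upper bounds
  \<open>q\<close> can be strict.\<close>

lemma off_oval_section_eq:
  assumes agr: "pairwise_agreeing F" and cF: "card F = CARD('a)\<^sup>2"
    and off: "\<And>p. p \<in> K \<Longrightarrow> vcross u p \<noteq> 0"
  shows "card {y \<in> F. y \<cdot> u = s} = CARD('a)"
proof -
  have "(\<Sum>s\<in>UNIV. card {y \<in> F. y \<cdot> u = s}) = (\<Sum>s\<in>(UNIV :: 'a set). CARD('a))"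
    using card_eq_sum_card_fibres[of F "\<lambda>y. y \<cdot> u"] cF by (simp add: power2_eq_square)
  from sum_mono_inv[OF this off_oval_section_le[OF agr off], of s] show ?thesis by simp
qed

lemma bij_betw_multiples_of_oval_points:
  "bij_betw (\<lambda>(p, c). c *s p) (K \<times> (UNIV - {0})) (UNIV - {0} - {u. \<forall>p\<in>K. vcross u p \<noteq> 0})"
  unfolding bij_betw_def
proof
  have "p = r \<and> c = d" if *: "p \<in> K" "r \<in> K" "c *s p = d *s r" "c \<noteq> 0" for p r c d
  proof -
    have "c *s vcross p r = 0"
      by (metis *(3) vcross_self vcross_smult_left vec.scale_zero_right)
    then have "p = r" using arc_vcross_neq_0[OF arc card_K_ge_3 *(1,2)] *(4) by auto
    then show ?thesis using * arc_neq_0[OF arc card_K_ge_3 *(1)] by simp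
  qed
  then show "inj_on (\<lambda>(p, c). c *s p) (K \<times> (UNIV - {0}))"
    by (intro inj_onI) (auto split: prod.splits)
  show "(\<lambda>(p, c). c *s p) ` (K \<times> (UNIV - {0})) = UNIV - {0} - {u. \<forall>p\<in>K. vcross u p \<noteq> 0}"
  proof (intro set_eqI iffI)
    fix u assume "u \<in> UNIV - {0} - {u. \<forall>p\<in>K. vcross u p \<noteq> 0}"
    then obtain p where p: "u \<noteq> 0" "p \<in> K" "vcross p u = 0"
      using vcross_antisym[of _ u] by auto
    then obtain c where c: "u = c *s p"
      using parallel_if_vcross_eq_0 arc_neq_0[OF arc card_K_ge_3] by blast
    moreover have "c \<noteq> 0" using c p by auto
    ultimately show "u \<in> (\<lambda>(p, c). c *s p) ` (K \<times> (UNIV - {0}))" using p(2) by force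
  next
    fix u assume "u \<in> (\<lambda>(p, c). c *s p) ` (K \<times> (UNIV - {0}))"
    then obtain p c where u: "u = c *s p" "p \<in> K" "c \<noteq> 0" by auto
    then have "vcross u p = 0" by (simp add: vcross_smult_left vcross_self)
    moreover have "u \<noteq> 0" using arc_neq_0[OF arc card_K_ge_3] u by auto
    ultimately show "u \<in> UNIV - {0} - {u. \<forall>p\<in>K. vcross u p \<noteq> 0}" using u(2) by blast
  qed
qed

text \<open>  Double count the pairs of a nonzero vector \<open>u\<close> and a member \<open>y\<close> of \<open>F\<close> with \<open>y \<cdot> u = x \<cdot> u\<close>.  A member
  \<open>y \<noteq> x\<close> occurs \<open>q\<^sup>2 - 1\<close> times, and \<open>y = x\<close> occurs \<open>q\<^sup>3 - 1\<close> times.  On the other side, each of the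
  \<open>q\<^sup>3 - q\<^sup>2\<close> vectors off the oval contributes \<open>q\<close>, and the \<open>q - 1\<close> multiples of each \<open>p \<in> K\<close> contribute
  equally.  Solving for the sum over \<open>K\<close> gives the claim.\<close>

lemma oval_sections_through:
  assumes agr: "pairwise_agreeing F" and cF: "card F = CARD('a)\<^sup>2"
  shows "(\<Sum>p\<in>K. int (card {y \<in> F. y \<cdot> p = x \<cdot> p})) = (if x \<in> F then 2 * (int CARD('a))\<^sup>2 else (int CARD('a))\<^sup>2)"
proof -
  define N where "N u = int (card {y \<in> F. y \<cdot> u = x \<cdot> u})" for u
  let ?U = "UNIV - {0 :: 'a ^ 3}" and ?V = "{u. \<forall>p\<in>K. vcross u p \<noteq> 0}"
  have V_U: "?V \<subseteq> ?U"
    using card_K_ge_3 by (auto simp: vcross_0_left)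
  have "(\<Sum>u\<in>?U - ?V. N u) = (\<Sum>(p, c)\<in>K \<times> (UNIV - {0}). N (c *s p))"
    using sum.reindex_bij_betw[OF bij_betw_multiples_of_oval_points, of N] by (simp add: case_prod_unfold)
  also have "\<dots> = (\<Sum>p\<in>K. \<Sum>c\<in>(UNIV :: 'a set) - {0}. N p)"
    unfolding sum.cartesian_product[symmetric]
    by (intro sum.cong) (auto simp: N_def dot_simps)
  also have "\<dots> = (int CARD('a) - 1) * (\<Sum>p\<in>K. N p)"
    using q_ge_3 by (simp add: sum_distrib_left card_Diff_singleton of_nat_diff)
  finally have on: "(\<Sum>u\<in>?U - ?V. N u) = (int CARD('a) - 1) * (\<Sum>p\<in>K. N p)" .
  have card_U: "card ?U = CARD('a) ^ 3 - 1" by (simp add: card_Diff_singleton)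
  have "card (?U - ?V) = (CARD('a) + 1) * (CARD('a) - 1)"
    using bij_betw_same_card[OF bij_betw_multiples_of_oval_points]
    by (simp add: card_cartesian_product card_K card_Diff_singleton)
  then have c1: "int (card (?U - ?V)) = (int CARD('a) + 1) * (int CARD('a) - 1)"
    using q_ge_3 by (simp only: of_nat_mult of_nat_diff of_nat_add) simp
  have c2: "int (card ?U) = int CARD('a) ^ 3 - 1"
    unfolding card_U by (simp add: of_nat_diff)
  have "card ?V \<le> card ?U" by (rule card_mono[OF _ V_U]) simp
  moreover have "card (?U - ?V) = card ?U - card ?V" by (rule card_Diff_subset[OF _ V_U]) simp
  ultimately have "int (card ?V) = int (card ?U) - int (card (?U - ?V))" by linarith
  then have "int (card ?V) = (int CARD('a) ^ 3 - 1) - (int CARD('a) + 1) * (int CARD('a) - 1)"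
    by (simp only: c1 c2)
  moreover
  have "N u = int CARD('a)" if "u \<in> ?V" for u
  proof -
    have "card {y \<in> F. y \<cdot> u = x \<cdot> u} = CARD('a)"
      by (rule off_oval_section_eq[OF agr cF]) (use that in blast)
    then show ?thesis unfolding N_def by (rule arg_cong)
  qed
  then have "(\<Sum>u\<in>?V. N u) = (\<Sum>u\<in>?V. int CARD('a))" by (rule sum.cong[OF refl])
  ultimately have off: "(\<Sum>u\<in>?V. N u) = ((int CARD('a) ^ 3 - 1) - (int CARD('a) + 1) * (int CARD('a) - 1)) * int CARD('a)"
    by (simp only: sum_constant)
  have "(\<Sum>u\<in>?U. N u) = (\<Sum>y\<in>F. int (card {u \<in> ?U. y \<cdot> u = x \<cdot> u}))"
    unfolding N_def of_nat_sum[symmetric] of_nat_eq_iff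
    by (rule sum_multicount_gen) auto
  also have "\<dots> = (\<Sum>y\<in>F. ((int CARD('a))\<^sup>2 - 1) + (if x = y then int CARD('a) ^ 3 - (int CARD('a))\<^sup>2 else 0))"
  proof (rule sum.cong)
    fix y assume "y \<in> F"
    show "int (card {u \<in> ?U. y \<cdot> u = x \<cdot> u}) = (int CARD('a))\<^sup>2 - 1 + (if x = y then int CARD('a) ^ 3 - (int CARD('a))\<^sup>2 else 0)"
    proof (cases "x = y")
      case True
      then show ?thesis using card_U q_ge_3 by (simp add: of_nat_diff set_diff_eq)
    next
      case False
      have "{u \<in> ?U. y \<cdot> u = x \<cdot> u} = {u. (x - y) \<cdot> u = 0} - {0}" by (auto simp: dot_simps)
      then show ?thesis
        using False q_ge_3 card_hyperplane[of "x - y" 0]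
        by (simp add: card_Diff_singleton dot_simps of_nat_diff)
    qed
  qed simp
  also have "\<dots> = (int CARD('a))\<^sup>2 * ((int CARD('a))\<^sup>2 - 1) + (if x \<in> F then int CARD('a) ^ 3 - (int CARD('a))\<^sup>2 else 0)"
    by (simp add: sum.distrib sum.delta cF)
  finally have "(\<Sum>u\<in>?U. N u) = \<dots>" .
  then have "(int CARD('a) - 1) * (\<Sum>p\<in>K. N p) + ((int CARD('a) ^ 3 - 1) - (int CARD('a) + 1) * (int CARD('a) - 1)) * int CARD('a)
      = (int CARD('a))\<^sup>2 * ((int CARD('a))\<^sup>2 - 1) + (if x \<in> F then int CARD('a) ^ 3 - (int CARD('a))\<^sup>2 else 0)"
    using on off sum.subset_diff[OF V_U, of N] by simp
  then have "(int CARD('a) - 1) * (\<Sum>p\<in>K. N p) = (int CARD('a) - 1) * (if x \<in> F then 2 * (int CARD('a))\<^sup>2 else (int CARD('a))\<^sup>2)"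
    by (simp add: algebra_simps power2_eq_square power3_eq_cube split: if_splits)
  then show ?thesis using q_ge_3 by (simp add: N_def)
qed

lemma bij_betw_third_coordinate:
  assumes "p \<in> K" "r \<in> K" "t \<in> K" "p \<noteq> r" "p \<noteq> t" "r \<noteq> t"
  shows "bij_betw (\<lambda>x. x \<cdot> t) {x. x \<cdot> p = a \<and> x \<cdot> r = b} UNIV"
proof -
  let ?h = "\<lambda>x. (x \<cdot> p, x \<cdot> r, x \<cdot> t)"
  have inj: "inj ?h"
  proof (rule injI)
    fix x y assume "?h x = ?h y"
    then have "x - y = 0"
      by (intro arc_eq_0_if_three_zeros[OF arc assms]) (auto simp: dot_simps)
    then show "x = y" by simp
  qed
  have surj: "surj ?h"
  proof (rule card_subset_eq)
    show "card (range ?h) = card (UNIV :: ('a \<times> 'a \<times> 'a) set)"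
      by (simp add: card_image[OF inj] UNIV_Times_UNIV[symmetric] card_cartesian_product power3_eq_cube
        del: UNIV_Times_UNIV)
  qed auto
  show ?thesis
    unfolding bij_betw_def
  proof
    show "inj_on (\<lambda>x. x \<cdot> t) {x. x \<cdot> p = a \<and> x \<cdot> r = b}"
    proof (rule inj_onI)
      fix x y assume "x \<in> {x. x \<cdot> p = a \<and> x \<cdot> r = b}" "y \<in> {x. x \<cdot> p = a \<and> x \<cdot> r = b}" "x \<cdot> t = y \<cdot> t"
      then have "?h x = ?h y" by simp
      then show "x = y" by (rule injD[OF inj])
    qed
    have "c \<in> (\<lambda>x. x \<cdot> t) ` {x. x \<cdot> p = a \<and> x \<cdot> r = b}" for c
    proof -
      have "(a, b, c) \<in> range ?h" using surj by simp
      then show ?thesis by auto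
    qed
    then show "(\<lambda>x. x \<cdot> t) ` {x. x \<cdot> p = a \<and> x \<cdot> r = b} = UNIV" by blast
  qed
qed

lemma sum_over_third_coordinate:
  assumes "p \<in> K" "r \<in> K" "t \<in> K" "p \<noteq> r" "p \<noteq> t" "r \<noteq> t"
  shows "(\<Sum>x | x \<cdot> p = a \<and> x \<cdot> r = b. int (card {y \<in> F. y \<cdot> t = x \<cdot> t})) = int (card F)"
proof -
  have "(\<Sum>x | x \<cdot> p = a \<and> x \<cdot> r = b. int (card {y \<in> F. y \<cdot> t = x \<cdot> t})) = (\<Sum>c\<in>UNIV. int (card {y \<in> F. y \<cdot> t = c}))"
    by (rule sum.reindex_bij_betw[OF bij_betw_third_coordinate[OF assms]])
  then show ?thesis using card_eq_sum_card_fibres[of F "\<lambda>y. y \<cdot> t"] by simp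
qed

text \<open>  Sum \<open>oval_sections_through\<close> over the \<open>q\<close> vectors \<open>x\<close> of the line.  The terms of \<open>p\<close> and \<open>r\<close> are constant on
  it, while every other \<open>t \<in> K\<close> takes each value once there and contributes \<open>\<bar>F\<bar> = q\<^sup>2\<close>.\<close>

lemma line_section:
  assumes agr: "pairwise_agreeing F" and cF: "card F = CARD('a)\<^sup>2"
    and pr: "p \<in> K" "r \<in> K" "p \<noteq> r"
  shows "int CARD('a) * int (card {y \<in> F. y \<cdot> p = a \<and> y \<cdot> r = b})
    = int (card {y \<in> F. y \<cdot> p = a}) + int (card {y \<in> F. y \<cdot> r = b}) - int CARD('a)"
proof -
  define n where "n t c = int (card {y \<in> F. y \<cdot> t = c})" for t c
  let ?L = "{x. x \<cdot> p = a \<and> x \<cdot> r = b}"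
  have card_L: "card ?L = CARD('a)"
  proof -
    obtain t where "t \<in> K" "t \<noteq> p" "t \<noteq> r" using ex_third[OF card_K_ge_3, of p r] by blast
    then show ?thesis
      by (intro bij_betw_same_card[OF bij_betw_third_coordinate[OF pr(1,2) _ pr(3)]]) auto
  qed
  have "(\<Sum>x\<in>?L. \<Sum>t\<in>K. n t (x \<cdot> t)) = (\<Sum>x\<in>?L. (int CARD('a))\<^sup>2 + (int CARD('a))\<^sup>2 * (if x \<in> F then 1 else 0))"
    unfolding n_def by (intro sum.cong) (simp_all add: oval_sections_through[OF agr cF])
  also have "\<dots> = int CARD('a) * (int CARD('a))\<^sup>2 + (int CARD('a))\<^sup>2 * (\<Sum>x\<in>?L. if x \<in> F then 1 else 0)"
    by (simp only: sum.distrib sum_distrib_left) (simp add: card_L)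
  also have "(\<Sum>x\<in>?L. if x \<in> F then 1 else 0) = int (card {y \<in> F. y \<cdot> p = a \<and> y \<cdot> r = b})"
  proof -
    have "{x \<in> ?L. x \<in> F} = {y \<in> F. y \<cdot> p = a \<and> y \<cdot> r = b}" by auto
    then show ?thesis by (simp add: sum.If_cases Int_def)
  qed
  finally have 1: "(\<Sum>x\<in>?L. \<Sum>t\<in>K. n t (x \<cdot> t)) = int CARD('a) * (int CARD('a))\<^sup>2
      + (int CARD('a))\<^sup>2 * int (card {y \<in> F. y \<cdot> p = a \<and> y \<cdot> r = b})" .
  have "(\<Sum>x\<in>?L. \<Sum>t\<in>K. n t (x \<cdot> t)) = (\<Sum>t\<in>K. \<Sum>x\<in>?L. n t (x \<cdot> t))" by (rule sum.swap)
  also have "\<dots> = (\<Sum>x\<in>?L. n p (x \<cdot> p)) + ((\<Sum>x\<in>?L. n r (x \<cdot> r)) + (\<Sum>t\<in>K - {p} - {r}. \<Sum>x\<in>?L. n t (x \<cdot> t)))"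
    using pr by (simp add: sum.remove[of K p] sum.remove[of "K - {p}" r])
  also have "(\<Sum>x\<in>?L. n p (x \<cdot> p)) = int CARD('a) * n p a" by (simp add: card_L)
  also have "(\<Sum>x\<in>?L. n r (x \<cdot> r)) = int CARD('a) * n r b" by (simp add: card_L)
  also have "(\<Sum>t\<in>K - {p} - {r}. \<Sum>x\<in>?L. n t (x \<cdot> t)) = (\<Sum>t\<in>K - {p} - {r}. (int CARD('a))\<^sup>2)"
    unfolding n_def using pr by (intro sum.cong) (auto simp: sum_over_third_coordinate cF)
  also have "\<dots> = (int CARD('a) - 1) * (int CARD('a))\<^sup>2"
    using pr q_ge_3 by (simp add: card_Diff_singleton card_K of_nat_diff)
  finally have "int CARD('a) * n p a + (int CARD('a) * n r b + (int CARD('a) - 1) * (int CARD('a))\<^sup>2)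
     = int CARD('a) * (int CARD('a))\<^sup>2 + (int CARD('a))\<^sup>2 * int (card {y \<in> F. y \<cdot> p = a \<and> y \<cdot> r = b})"
    using 1 by simp
  then have "int CARD('a) * (int CARD('a) * int (card {y \<in> F. y \<cdot> p = a \<and> y \<cdot> r = b})) = int CARD('a) * (n p a + n r b - int CARD('a))"
    by (simp add: algebra_simps power2_eq_square)
  then show ?thesis using q_ge_3 by (simp add: n_def)
qed

text \<open>  Write \<open>n p a\<close> for the number of \<open>y \<in> F\<close> with \<open>y \<cdot> p = a\<close>, and sum \<open>oval_sections_through\<close> over the
  members \<open>x\<close> of \<open>F\<close> with \<open>x \<cdot> p = a\<close>.  The right hand side becomes
  linear in \<open>n p a\<close>, the term of \<open>p\<close> becomes its square, and by \<open>line_section\<close> the term of another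
  \<open>t \<in> K\<close> is affine in \<open>n p a\<close>, with coefficients independent of \<open>a\<close>.\<close>

lemma section_quadratic:
  assumes agr: "pairwise_agreeing F" and cF: "card F = CARD('a)\<^sup>2" and p: "p \<in> K"
  shows "\<exists>C. \<forall>a. (int (card {y \<in> F. y \<cdot> p = a}))\<^sup>2 - (int CARD('a))\<^sup>2 * int (card {y \<in> F. y \<cdot> p = a}) = C"
proof -
  define n where "n t c = int (card {y \<in> F. y \<cdot> t = c})" for t c
  define M where "M = (\<Sum>t\<in>K - {p}. \<Sum>b\<in>UNIV. (n t b)\<^sup>2)"
  have sum_n: "(\<Sum>b\<in>UNIV. n t b) = (int CARD('a))\<^sup>2" for t
    using card_eq_sum_card_fibres[of F "\<lambda>y. y \<cdot> t"] cF by (simp add: n_def flip: of_nat_sum)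
  have "int CARD('a) * (n p a)\<^sup>2 - int CARD('a) ^ 3 * n p a = int CARD('a) ^ 4 - M" for a
  proof -
    let ?S = "{x \<in> F. x \<cdot> p = a}"
    have "(\<Sum>x\<in>?S. \<Sum>t\<in>K. n t (x \<cdot> t)) = (\<Sum>x\<in>?S. 2 * (int CARD('a))\<^sup>2)"
      unfolding n_def by (intro sum.cong) (simp_all add: oval_sections_through[OF agr cF])
    also have "\<dots> = 2 * (int CARD('a))\<^sup>2 * n p a" by (simp add: n_def)
    finally have 1: "(\<Sum>x\<in>?S. \<Sum>t\<in>K. n t (x \<cdot> t)) = \<dots>" .
    have other: "int CARD('a) * (\<Sum>x\<in>?S. n t (x \<cdot> t)) = n p a * (int CARD('a))\<^sup>2 - int CARD('a) ^ 3 + (\<Sum>b\<in>UNIV. (n t b)\<^sup>2)"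
      if t: "t \<in> K - {p}" for t
    proof -
      have "(\<Sum>x\<in>?S. n t (x \<cdot> t)) = (\<Sum>b\<in>UNIV. \<Sum>x | x \<in> ?S \<and> x \<cdot> t = b. n t (x \<cdot> t))"
        using sum.group[of ?S "UNIV :: 'a set" "\<lambda>x. x \<cdot> t" "\<lambda>x. n t (x \<cdot> t)"] by simp
      also have "\<dots> = (\<Sum>b\<in>UNIV. n t b * int (card {y \<in> F. y \<cdot> p = a \<and> y \<cdot> t = b}))"
        by (intro sum.cong) (simp_all add: conj_ac)
      finally have "int CARD('a) * (\<Sum>x\<in>?S. n t (x \<cdot> t))
          = (\<Sum>b\<in>UNIV. n t b * (int CARD('a) * int (card {y \<in> F. y \<cdot> p = a \<and> y \<cdot> t = b})))"
        by (simp add: sum_distrib_left mult.left_commute)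
      also have "\<dots> = (\<Sum>b\<in>UNIV. n t b * (n p a + n t b - int CARD('a)))"
      proof -
        have "t \<in> K" "p \<noteq> t" using t by auto
        from line_section[OF agr cF p this] show ?thesis by (simp only: n_def)
      qed
      also have "\<dots> = (\<Sum>b\<in>UNIV. (n p a - int CARD('a)) * n t b + (n t b)\<^sup>2)"
        by (intro sum.cong) (simp_all add: algebra_simps power2_eq_square)
      also have "\<dots> = (n p a - int CARD('a)) * (int CARD('a))\<^sup>2 + (\<Sum>b\<in>UNIV. (n t b)\<^sup>2)"
        by (simp add: sum.distrib sum_n flip: sum_distrib_left)
      finally show ?thesis by (simp add: algebra_simps power2_eq_square power3_eq_cube)
    qed
    have "int CARD('a) * (\<Sum>x\<in>?S. \<Sum>t\<in>K. n t (x \<cdot> t)) = int CARD('a) * (\<Sum>t\<in>K. \<Sum>x\<in>?S. n t (x \<cdot> t))"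
      by (subst sum.swap) simp
    also have "\<dots> = int CARD('a) * (\<Sum>x\<in>?S. n p (x \<cdot> p)) + (\<Sum>t\<in>K - {p}. int CARD('a) * (\<Sum>x\<in>?S. n t (x \<cdot> t)))"
      using p by (simp add: sum.remove[of K p] sum_distrib_left distrib_left)
    also have "(\<Sum>x\<in>?S. n p (x \<cdot> p)) = n p a * n p a" by (simp add: n_def)
    also have "(\<Sum>t\<in>K - {p}. int CARD('a) * (\<Sum>x\<in>?S. n t (x \<cdot> t)))
        = (\<Sum>t\<in>K - {p}. n p a * (int CARD('a))\<^sup>2 - int CARD('a) ^ 3 + (\<Sum>b\<in>UNIV. (n t b)\<^sup>2))"
      by (intro sum.cong other refl)
    also have "\<dots> = int CARD('a) * (n p a * (int CARD('a))\<^sup>2 - int CARD('a) ^ 3) + M"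
      using p by (simp add: sum.distrib M_def card_Diff_singleton card_K)
    finally show ?thesis
      unfolding 1 by (simp add: algebra_simps power2_eq_square power3_eq_cube power4_eq_xxxx)
  qed
  note eq = this
  have "(n p a)\<^sup>2 - (int CARD('a))\<^sup>2 * n p a = (n p 0)\<^sup>2 - (int CARD('a))\<^sup>2 * n p 0" for a
  proof -
    have "int CARD('a) * ((n p a)\<^sup>2 - (int CARD('a))\<^sup>2 * n p a) = int CARD('a) * ((n p 0)\<^sup>2 - (int CARD('a))\<^sup>2 * n p 0)"
      using eq[of a] eq[of 0] by (simp add: algebra_simps power2_eq_square power3_eq_cube)
    then show ?thesis using q_ge_3 by simp
  qed
  then show ?thesis unfolding n_def by blast
qed

text \<open>  If two values \<open>a\<close>, \<open>b\<close> of some coordinate \<open>y \<cdot> p\<close> occur with different frequencies, the quadratic relation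
  forces these frequencies to add up to \<open>q\<^sup>2 = \<bar>F\<bar>\<close>.  A third value, available since \<open>q \<ge> 3\<close>, then
  does not occur, so that \<open>0\<close> and \<open>q\<^sup>2\<close> are the two solutions of the relation.  Uniform frequencies in all
  coordinates are excluded by evaluating \<open>oval_sections_through\<close> at a member of \<open>F\<close>.\<close>

lemma ex_full_section:
  assumes agr: "pairwise_agreeing F" and cF: "card F = CARD('a)\<^sup>2"
  shows "\<exists>p\<in>K. \<exists>a. F = {x. x \<cdot> p = a}"
proof -
  define n where "n t c = int (card {y \<in> F. y \<cdot> t = c})" for t c
  have sum_n: "(\<Sum>b\<in>UNIV. n t b) = (int CARD('a))\<^sup>2" for t
    using card_eq_sum_card_fibres[of F "\<lambda>y. y \<cdot> t"] cF by (simp add: n_def flip: of_nat_sum)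
  have "\<exists>p\<in>K. \<exists>a b. n p a \<noteq> n p b"
  proof (rule ccontr)
    assume "\<not> ?thesis"
    then have const: "n p a = n p b" if "p \<in> K" for p a b using that by blast
    have nq: "n p a = int CARD('a)" if "p \<in> K" for p a
    proof -
      have "(\<Sum>b\<in>UNIV. n p b) = (\<Sum>b\<in>(UNIV :: 'a set). n p a)"
        by (rule sum.cong) (auto intro: const[OF that])
      then show ?thesis using sum_n[of p] q_ge_3 by (simp add: power2_eq_square)
    qed
    have "F \<noteq> {}" using cF q_ge_3 by auto
    then obtain x where x: "x \<in> F" by blast
    have "(\<Sum>p\<in>K. n p (x \<cdot> p)) = 2 * (int CARD('a))\<^sup>2"
      using oval_sections_through[OF agr cF, of x] x by (simp add: n_def)
    then have "(int CARD('a) + 1) * int CARD('a) = 2 * int CARD('a) * int CARD('a)" using nq by (simp add: card_K power2_eq_square)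
    then show False using q_ge_3 by simp
  qed
  then obtain p a b where p: "p \<in> K" and ab: "n p a \<noteq> n p b" by blast
  have quad: "n p c = n p d \<or> n p c + n p d = (int CARD('a))\<^sup>2" for c d
  proof -
    have "(n p c)\<^sup>2 - (int CARD('a))\<^sup>2 * n p c = (n p d)\<^sup>2 - (int CARD('a))\<^sup>2 * n p d"
      using section_quadratic[OF agr cF p] unfolding n_def by metis
    then have "(n p c - n p d) * (n p c + n p d - (int CARD('a))\<^sup>2) = 0"
      by (simp add: algebra_simps power2_eq_square)
    then show ?thesis by auto
  qed
  obtain c where c: "c \<noteq> a" "c \<noteq> b"
    using ex_third[of "UNIV :: 'a set" a b] q_ge_3 by auto
  have nonneg: "n t d \<ge> 0" for t d by (simp add: n_def)
  have "(\<Sum>d\<in>{a, b, c}. n p d) \<le> (\<Sum>d\<in>UNIV. n p d)"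
    by (intro sum_mono2) (auto simp: nonneg)
  moreover have "a \<noteq> b" using ab by auto
  ultimately have "n p a + n p b + n p c \<le> (int CARD('a))\<^sup>2"
    using c sum_n[of p] by (auto simp: add.assoc)
  then have "n p c = 0" using quad[of a b] ab nonneg[of p c] by linarith
  then have "\<exists>d. n p d = (int CARD('a))\<^sup>2"
    using quad[of a b] quad[of a c] ab by fastforce
  then obtain d where "int (card {y \<in> F. y \<cdot> p = d}) = int (CARD('a)\<^sup>2)"
    by (auto simp: n_def)
  then have d: "card {y \<in> F. y \<cdot> p = d} = CARD('a)\<^sup>2"
    by (simp only: of_nat_eq_iff)
  have "{y \<in> F. y \<cdot> p = d} = F" using d cF by (intro card_subset_eq) auto
  moreover have "{y \<in> F. y \<cdot> p = d} = {x. x \<cdot> p = d}"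
    using d card_hyperplane[OF arc_neq_0[OF arc card_K_ge_3 p], of d]
    by (intro card_subset_eq) (auto simp: dot_commute[of _ p])
  ultimately show ?thesis using p by metis
qed

end

section \<open>Coordinates for oval cones\<close>

lemma proj_point_iff: "P \<in> proj_points \<longleftrightarrow> (\<exists>v. v \<noteq> 0 \<and> P = vec.span {v})"
  for P :: "('a::field ^ 'n) set"
proof
  assume "P \<in> proj_points"
  then have P: "vec.subspace P" "vec.dim P = 1" by (auto simp: proj_subspaces_def)
  obtain B where B: "vec.independent B" "vec.span B = P" "card B = 1"
    using vec.basis_subspace_exists[OF P(1)] P(2) by metis
  then obtain v where "B = {v}" by (auto simp: card_1_singleton_iff)
  then show "\<exists>v. v \<noteq> 0 \<and> P = vec.span {v}" using B by (auto simp: vec.dependent_single)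
next
  assume "\<exists>v. v \<noteq> 0 \<and> P = vec.span {v}"
  then show "P \<in> proj_points"
    by (auto simp: proj_subspaces_def vec.dim_span vec.dim_insert vec.dim_empty)
qed

lemma span_scale: "c \<noteq> 0 \<Longrightarrow> vec.span {c *s v} = vec.span {v}"
  for v :: "'a::field ^ 'n"
proof -
  assume c: "c \<noteq> 0"
  have "k *s v \<in> range (\<lambda>k. k *s (c *s v))" for k
    using c by (intro range_eqI[of _ _ "k / c"]) simp
  then show ?thesis by (auto simp: vec.span_singleton)
qed

lemma mem_points_on_span:
  assumes "vec.subspace U" "v \<noteq> 0"
  shows "vec.span {v} \<in> points_on U \<longleftrightarrow> v \<in> U"
  using assms vec.span_base[of v "{v}"] vec.span_minimal[of "{v}" U]
  by (auto simp: points_on_def proj_point_iff)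

text \<open>  Four vectors of a three-dimensional space satisfy a linear relation whose coefficients are triple
  products; here one coefficient vanishes, and \<open>e\<close> makes that of \<open>t\<close> equal to \<open>1\<close>.\<close>

lemma combination_if_coplanar:
  fixes p s t :: "'a::field ^ 3"
  assumes "vcross p s \<noteq> 0" "vcross p s \<cdot> t = 0"
  shows "\<exists>\<alpha> \<beta>. t = \<alpha> *s p + \<beta> *s s"
proof -
  obtain e where e: "vcross p s \<cdot> e = 1" using ex_dot_eq_1[OF assms(1)] by blast
  have "(vcross p s \<cdot> e) *s t = (vcross t s \<cdot> e) *s p + (vcross p t \<cdot> e) *s s + (vcross p s \<cdot> t) *s e"
    by (simp add: vcross_def dot3 vec_eq_iff forall_3 algebra_simps)
  then show ?thesis using assms(2) e by auto
qed

text \<open>  The vector \<open>r\<close> spans the vertex, and \<open>E\<close> parametrises the plane of the oval by coordinates.\<close>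

locale affine_chart =
  fixes r :: "'a::{field,finite} ^ 4" and E :: "'a ^ 3 \<Rightarrow> 'a ^ 4"
  assumes lin: "Vector_Spaces.linear (*s) (*s) E" and inj: "inj E" and r_notin: "r \<notin> range E"
begin

definition T :: "'a ^ 3 \<Rightarrow> 'a \<Rightarrow> 'a ^ 4" where
  "T c t = E c + t *s r"

lemmas E_add = vec.linear_add[OF lin] and E_scale = vec.linear_scale[OF lin]

lemma E_0: "E 0 = 0"
  using E_scale[of 0 0] by simp

lemma T_add: "T (c + d) (s + t) = T c s + T d t"
  by (simp add: T_def E_add algebra_simps)

lemma T_scale: "T (k *s c) (k * t) = k *s T c t"
  by (simp add: T_def E_scale algebra_simps)

lemma r_eq_T: "r = T 0 1"
  by (simp add: T_def E_0)

lemma T_eq_0_iff: "T c t = 0 \<longleftrightarrow> c = 0 \<and> t = 0"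
proof
  assume 0: "T c t = 0"
  have "t = 0"
  proof (rule ccontr)
    assume "t \<noteq> 0"
    have "E c = (- t) *s r" using 0 by (simp add: T_def eq_neg_iff_add_eq_0)
    then have "E ((- 1 / t) *s c) = (- 1 / t) *s ((- t) *s r)" by (simp only: E_scale)
    then have "r = E ((- 1 / t) *s c)" using \<open>t \<noteq> 0\<close> by simp
    then show False using r_notin by blast
  qed
  moreover from this have "E c = E 0" using 0 by (simp add: T_def E_0)
  ultimately show "c = 0 \<and> t = 0" using injD[OF inj] by blast
qed (simp add: T_def E_0)

lemma T_eq_iff: "T c s = T d t \<longleftrightarrow> c = d \<and> s = t"
proof -
  have "T (c - d) (s - t) + T d t = T c s" by (simp flip: T_add)
  then have "T c s = T d t \<longleftrightarrow> T (c - d) (s - t) = 0" by (metis add_0 add_right_cancel)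
  then show ?thesis by (simp add: T_eq_0_iff)
qed

lemma T_0_eq: "T 0 k = k *s r"
  by (simp add: T_def E_0)

text \<open>  For fixed \<open>c \<noteq> 0\<close> these are the points other than the vertex on the line through the vertex and \<open>\<langle>E c\<rangle>\<close>.\<close>

definition affine_point :: "'a ^ 3 \<Rightarrow> 'a \<Rightarrow> ('a ^ 4) set" where
  "affine_point c t = vec.span {T c t}"

lemma affine_point_eqD:
  assumes "affine_point c s = affine_point d t"
  shows "\<exists>k. c = k *s d \<and> s = k * t"
proof -
  have "T c s \<in> vec.span {T d t}"
    using assms vec.span_base[of "T c s" "{T c s}"] by (simp add: affine_point_def)
  then obtain k where "T c s = k *s T d t" by (auto simp: vec.span_singleton)
  then show ?thesis by (auto simp: T_eq_iff simp flip: T_scale)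
qed

lemma points_on_generator:
  assumes "p \<noteq> 0"
  shows "points_on (line_through (vec.span {r}) (affine_point p 0)) - {vec.span {r}} = range (affine_point p)"
proof -
  have line: "x \<in> line_through (vec.span {r}) (affine_point p 0) \<longleftrightarrow> (\<exists>k l. x = T (k *s p) l)" for x
  proof -
    have "x \<in> line_through (vec.span {r}) (affine_point p 0) \<longleftrightarrow> (\<exists>l k. x = l *s r + k *s E p)"
      unfolding line_through_def affine_point_def vec.span_Un vec.span_span
      unfolding vec.span_singleton
      by (auto simp: T_def)
    then show ?thesis by (auto simp: T_def E_scale add.commute)
  qed
  have sub: "vec.subspace (line_through (vec.span {r}) (affine_point p 0))"
    by (simp add: line_through_def vec.subspace_span)
  show ?thesis
  proof (intro set_eqI iffI)
    fix X assume X: "X \<in> points_on (line_through (vec.span {r}) (affine_point p 0)) - {vec.span {r}}"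
    then obtain x where x: "x \<noteq> 0" "X = vec.span {x}" by (auto simp: points_on_def proj_point_iff)
    then have "x \<in> line_through (vec.span {r}) (affine_point p 0)"
      using X mem_points_on_span[OF sub] by auto
    then obtain k l where kl: "x = T (k *s p) l" using line by blast
    have k: "k \<noteq> 0"
    proof
      assume "k = 0"
      then have "x = l *s r" using kl by (simp add: T_0_eq)
      then show False using X x span_scale[of l r] by auto
    qed
    then have "x = k *s T p (l / k)" using kl by (simp flip: T_scale)
    then have "X = affine_point p (l / k)" using x(2) span_scale[OF k] by (simp add: affine_point_def)
    then show "X \<in> range (affine_point p)" by simp
  next
    fix X assume "X \<in> range (affine_point p)"
    then obtain a where a: "X = affine_point p a" by auto
    have "T p a \<in> line_through (vec.span {r}) (affine_point p 0)"
      unfolding line by (intro exI[of _ 1] exI[of _ a]) simp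
    then have "X \<in> points_on (line_through (vec.span {r}) (affine_point p 0))"
      using mem_points_on_span[OF sub] assms by (simp add: a affine_point_def T_eq_0_iff)
    moreover have "X \<noteq> vec.span {r}"
    proof
      assume "X = vec.span {r}"
      then have "affine_point p a = affine_point 0 1" by (simp add: a affine_point_def flip: r_eq_T)
      then show False using affine_point_eqD[of p a 0 1] assms by auto
    qed
    ultimately show "X \<in> points_on (line_through (vec.span {r}) (affine_point p 0)) - {vec.span {r}}"
      by blast
  qed
qed

definition graph_plane :: "'a ^ 3 \<Rightarrow> ('a ^ 4) set" where
  "graph_plane m = range (\<lambda>c. T c (m \<cdot> c))"

lemma mem_graph_plane: "T c t \<in> graph_plane m \<longleftrightarrow> t = m \<cdot> c"
  by (auto simp: graph_plane_def T_eq_iff)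

lemma graph_plane_in_proj_planes: "graph_plane m \<in> proj_planes"
proof -
  let ?g = "\<lambda>c. T c (m \<cdot> c)"
  have lin': "Vector_Spaces.linear (*s) (*s) ?g"
    unfolding Vector_Spaces.linear_iff
    by (simp add: vec.vector_space_axioms dot_simps T_add T_scale)
  have "inj ?g" by (simp add: inj_def T_eq_iff)
  then have "vec.dim (graph_plane m) = 3"
    using vec.dim_image_eq[OF lin', of UNIV] by (simp add: graph_plane_def card_cart_basis)
  moreover have "vec.subspace (graph_plane m)"
    unfolding graph_plane_def by (rule vec.linear_subspace_image[OF lin' vec.subspace_UNIV])
  ultimately show ?thesis by (simp add: proj_subspaces_def)
qed

lemma r_notin_graph_plane: "r \<notin> graph_plane m"
  using mem_graph_plane[of 0 1 m] by (simp add: dot_simps flip: r_eq_T)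

text \<open>  Together with \<open>r\<close> the plane spans the whole space, so for each \<open>c\<close> it contains a vector \<open>T c t\<close>.  Taking
  unit vectors for \<open>c\<close> yields the coefficients of the linear form, and equality follows by dimension.\<close>

lemma plane_off_vertex_is_graph:
  assumes "\<rho> \<in> proj_planes" "r \<notin> \<rho>"
  shows "\<exists>m. \<rho> = graph_plane m"
proof -
  have \<rho>: "vec.subspace \<rho>" "vec.dim \<rho> = 3" using assms by (auto simp: proj_subspaces_def)
  have sp: "vec.span \<rho> = \<rho>" using \<rho>(1) by (simp add: vec.span_eq_iff)
  have "vec.dim (insert r \<rho>) = 4" using \<rho> assms(2) by (simp add: vec.dim_insert sp)
  then have "vec.span (insert r \<rho>) = UNIV"
    by (simp add: vec.dimension_def card_cart_basis flip: vec.dim_eq_full)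
  then have "\<exists>k. x - k *s r \<in> \<rho>" for x
    using vec.span_breakdown_eq[of x r \<rho>] by (simp add: sp)
  then have "\<exists>k. E c - k *s r \<in> \<rho>" for c by blast
  then obtain k where k: "\<And>c. E c - k c *s r \<in> \<rho>" by metis
  define m :: "'a ^ 3" where "m = (\<chi> i. - k (axis i 1))"
  have ax: "T (axis i 1) (m $ i) \<in> \<rho>" for i
    using k[of "axis i 1"] by (simp add: T_def m_def)
  have "T c (m \<cdot> c) \<in> \<rho>" for c
  proof -
    have c: "c = c$1 *s axis 1 1 + c$2 *s axis 2 1 + c$3 *s axis 3 1"
      by (simp add: vec_eq_iff forall_3 axis_def)
    have mc: "m \<cdot> c = c$1 * m$1 + c$2 * m$2 + c$3 * m$3" by (simp add: dot3 mult.commute)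
    have "T c (m \<cdot> c) = c$1 *s T (axis 1 1) (m$1) + c$2 *s T (axis 2 1) (m$2) + c$3 *s T (axis 3 1) (m$3)"
      unfolding mc by (subst c) (simp only: T_add T_scale)
    also have "\<dots> \<in> \<rho>" by (intro vec.subspace_add vec.subspace_scale \<rho>(1) ax)
    finally show ?thesis .
  qed
  then have "graph_plane m \<subseteq> \<rho>" by (auto simp: graph_plane_def)
  moreover have "vec.subspace (graph_plane m)" "vec.dim (graph_plane m) = 3"
    using graph_plane_in_proj_planes[of m] by (auto simp: proj_subspaces_def)
  ultimately have "graph_plane m = \<rho>" using vec.subspace_dim_equal[of "graph_plane m" \<rho>] \<rho> by simp
  then show ?thesis by blast
qed

lemma oval_coordinates:
  assumes oval: "oval_in (range E) \<O>"
  shows "\<exists>K. arc K \<and> card K = CARD('a) + 1 \<and> 0 \<notin> K \<and> inj_on (\<lambda>p. affine_point p 0) K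
    \<and> \<O> = (\<lambda>p. affine_point p 0) ` K"
proof -
  \<comment> \<open>\<open>K\<close> contains one vector for each point of the oval.\<close>
  have "\<exists>v. v \<noteq> 0 \<and> P = affine_point v 0" if "P \<in> \<O>" for P
  proof -
    have "P \<in> points_on (range E)" using oval that by (auto simp: oval_in_def)
    then obtain w where w: "w \<noteq> 0" "P = vec.span {w}" "P \<subseteq> range E"
      by (auto simp: points_on_def proj_point_iff)
    moreover from this have "w \<in> range E" using vec.span_base[of w "{w}"] by auto
    ultimately obtain c where "w = E c" "c \<noteq> 0" using E_0 by auto
    then show ?thesis using w(2) by (auto simp: affine_point_def T_def)
  qed
  then obtain v where v: "\<And>P. P \<in> \<O> \<Longrightarrow> v P \<noteq> 0" "\<And>P. P \<in> \<O> \<Longrightarrow> P = affine_point (v P) 0"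
    by metis
  define K where "K = v ` \<O>"
  have injv: "inj_on v \<O>" by (rule inj_onI) (metis v(2))
  have injK: "inj_on (\<lambda>p. affine_point p 0) K"
    unfolding K_def by (auto intro!: inj_onI simp: v(2)[symmetric])
  have img: "\<O> = (\<lambda>p. affine_point p 0) ` K"
    unfolding K_def image_image using v(2) by force
  have K0: "0 \<notin> K" using v(1) by (auto simp: K_def)
  have "arc K"
    unfolding arc_def
  proof (intro ballI impI notI)
    fix p s t assume *: "p \<in> K" "s \<in> K" "t \<in> K" "p \<noteq> s" "p \<noteq> t" "s \<noteq> t" and 0: "vcross p s \<cdot> t = 0"
    have p0: "p \<noteq> 0" and s0: "s \<noteq> 0" and t0: "t \<noteq> 0" using * K0 by auto
    have ps: "vcross p s \<noteq> 0"
    proof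
      assume "vcross p s = 0"
      then obtain c where c: "s = c *s p" using parallel_if_vcross_eq_0[OF p0] by blast
      then have "c \<noteq> 0" using * K0 by auto
      then have "affine_point s 0 = affine_point p 0"
        using span_scale[of c "T p 0"] T_scale[of c p 0] by (simp add: affine_point_def c)
      then show False using inj_onD[OF injK] * by metis
    qed
    obtain \<alpha> \<beta> where t: "t = \<alpha> *s p + \<beta> *s s" using combination_if_coplanar[OF ps 0] by blast
    let ?l = "vec.span {E p, E s}"
    have "E p \<notin> vec.span {E s}"
    proof
      assume "E p \<in> vec.span {E s}"
      then obtain k where "E p = E (k *s s)" by (auto simp: vec.span_singleton E_scale)
      then have "p = k *s s" using injD[OF inj] by blast
      then show False using ps by (simp add: vcross_smult_left vcross_self)
    qed
    moreover have "E s \<noteq> 0"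
      using injD[OF inj, of s 0] * K0 E_0 by auto
    ultimately have "?l \<in> proj_lines"
      by (simp add: proj_subspaces_def vec.dim_span vec.dim_insert)
    moreover have "{affine_point p 0, affine_point s 0, affine_point t 0} \<subseteq> points_on ?l"
    proof -
      have on: "affine_point x 0 \<in> points_on ?l" if "x \<noteq> 0" "E x \<in> ?l" for x
        unfolding affine_point_def using that
        by (subst mem_points_on_span) (auto simp: vec.subspace_span T_eq_0_iff, simp add: T_def)
      have ps: "E p \<in> ?l" "E s \<in> ?l" by (auto intro: vec.span_base)
      then have "E t \<in> ?l"
        unfolding t E_add E_scale by (intro vec.span_add vec.span_scale)
      with ps show ?thesis by (simp add: on p0 s0 t0)
    qed
    ultimately have "proj_collinear {affine_point p 0, affine_point s 0, affine_point t 0}"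
      unfolding proj_collinear_def by blast
    moreover have "card {affine_point p 0, affine_point s 0, affine_point t 0} = 3"
      using * inj_on_eq_iff[OF injK] by simp
    moreover have "{affine_point p 0, affine_point s 0, affine_point t 0} \<subseteq> \<O>"
      using * img by auto
    ultimately show False using oval unfolding oval_in_def by blast
  qed
  moreover have "card K = CARD('a) + 1"
    using oval card_image[OF injv] by (simp add: K_def oval_in_def)
  ultimately show ?thesis using K0 injK img by blast
qed

end

text \<open>  \<open>h (p, a)\<close> is the point \<open>\<langle>E p + a *s r\<rangle>\<close> of the generator through \<open>p\<close>, and the circle \<open>m\<close> is the section of
  the cone by the graph of \<open>m\<close>.\<close>

lemma oval_cone_coordinates:
  fixes R :: "('a::{field,finite} ^ 4) set"
  assumes "oval_cone R \<Q>"
  shows "\<exists>(K :: ('a ^ 3) set) h. arc K \<and> card K = CARD('a) + 1 \<and> bij_betw h (K \<times> UNIV) (\<Q> - {R})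
    \<and> cone_circles R \<Q> = range (\<lambda>m. (\<lambda>p. h (p, m \<cdot> p)) ` K)"
proof -
  obtain \<pi> \<O> where R: "R \<in> proj_points" and \<pi>: "\<pi> \<in> proj_planes" and oval: "oval_in \<pi> \<O>"
    and R\<pi>: "R \<notin> points_on \<pi>" and Q: "\<Q> = (\<Union>P\<in>\<O>. points_on (line_through R P))"
    using assms by (auto simp: oval_cone_def)
  obtain r where r: "r \<noteq> 0" "R = vec.span {r}" using R by (auto simp: proj_point_iff)
  have \<pi>': "vec.subspace \<pi>" "vec.dim \<pi> = 3" using \<pi> by (auto simp: proj_subspaces_def)
  have "vec.dim (UNIV :: ('a ^ 3) set) = vec.dim \<pi>" by (simp add: \<pi>' card_cart_basis)
  then obtain E :: "'a ^ 3 \<Rightarrow> 'a ^ 4"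
    where E: "Vector_Spaces.linear (*s) (*s) E" "range E = \<pi>" "inj E"
    using vec.subspace_isomorphism[OF vec.subspace_UNIV \<pi>'(1)] by metis
  have "r \<notin> range E"
    using R\<pi> r mem_points_on_span[OF \<pi>'(1)] E(2) by auto
  then interpret affine_chart r E
    by (rule affine_chart.intro[OF E(1,3)])
  obtain K where K: "arc K" "card K = CARD('a) + 1" "0 \<notin> K" "inj_on (\<lambda>p. affine_point p 0) K"
    "\<O> = (\<lambda>p. affine_point p 0) ` K"
    using oval_coordinates oval E(2) by metis
  let ?h = "\<lambda>(p, a). affine_point p a"
  have img: "?h ` (K \<times> UNIV) = \<Q> - {R}"
  proof -
    have "\<Q> - {R} = (\<Union>p\<in>K. points_on (line_through (vec.span {r}) (affine_point p 0)) - {vec.span {r}})"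
      unfolding Q K(5) r(2) by auto
    also have "\<dots> = (\<Union>p\<in>K. range (affine_point p))"
      by (intro SUP_cong refl points_on_generator) (use K(3) in auto)
    finally show ?thesis by auto
  qed
  moreover have "inj_on ?h (K \<times> UNIV)"
  proof (rule inj_onI)
    fix x y assume x: "x \<in> K \<times> (UNIV :: 'a set)" and y: "y \<in> K \<times> (UNIV :: 'a set)" and "?h x = ?h y"
    obtain p a where pa: "x = (p, a)" "p \<in> K" using x by auto
    obtain s b where sb: "y = (s, b)" "s \<in> K" using y by auto
    obtain k where k: "p = k *s s" "a = k * b"
      using affine_point_eqD[of p a s b] \<open>?h x = ?h y\<close> pa sb by auto
    have "k \<noteq> 0" using k pa K(3) by auto
    then have "affine_point p 0 = affine_point s 0"
      using span_scale[of k "T s 0"] T_scale[of k s 0] by (simp add: affine_point_def k)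
    then have "p = s" using inj_onD[OF K(4)] pa sb by metis
    moreover have "k = 1"
    proof -
      have "k *s s = 1 *s s" using k(1) \<open>p = s\<close> by simp
      then show ?thesis unfolding vec.scale_cancel_right using sb K(3) by auto
    qed
    ultimately show "x = y" using k pa sb by simp
  qed
  moreover have "cone_circles R \<Q> = range (\<lambda>m. (\<lambda>p. ?h (p, m \<cdot> p)) ` K)"
  proof -
    have circle: "points_on (graph_plane m) \<inter> \<Q> = (\<lambda>p. ?h (p, m \<cdot> p)) ` K" for m
    proof -
      have sub: "vec.subspace (graph_plane m)"
        using graph_plane_in_proj_planes[of m] by (simp add: proj_subspaces_def)
      have "R \<notin> points_on (graph_plane m)"
        using mem_points_on_span[OF sub r(1)] r_notin_graph_plane r(2) by simp
      then have "points_on (graph_plane m) \<inter> \<Q> = points_on (graph_plane m) \<inter> ?h ` (K \<times> UNIV)"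
        unfolding img by auto
      also have "\<dots> = {affine_point p a | p a. p \<in> K \<and> a = m \<cdot> p}"
      proof -
        have "affine_point p a \<in> points_on (graph_plane m) \<longleftrightarrow> a = m \<cdot> p" if "p \<in> K" for p a
        proof -
          have "T p a \<noteq> 0" using that K(3) by (auto simp: T_eq_0_iff)
          then show ?thesis
            using mem_points_on_span[OF sub, of "T p a"] by (simp add: affine_point_def mem_graph_plane)
        qed
        then show ?thesis by auto
      qed
      finally show ?thesis by auto
    qed
    have "{\<rho> \<in> proj_planes. R \<notin> points_on \<rho>} = range graph_plane"
    proof (intro set_eqI iffI)
      fix \<rho> assume "\<rho> \<in> {\<rho> \<in> proj_planes. R \<notin> points_on \<rho>}"
      then have \<rho>: "\<rho> \<in> proj_planes" "R \<notin> points_on \<rho>" by auto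
      then have "r \<notin> \<rho>" using mem_points_on_span[of \<rho> r] r by (auto simp: proj_subspaces_def)
      then show "\<rho> \<in> range graph_plane" using plane_off_vertex_is_graph \<rho>(1) by blast
    next
      fix \<rho> assume "\<rho> \<in> range graph_plane"
      then obtain m where m: "\<rho> = graph_plane m" by auto
      then show "\<rho> \<in> {\<rho> \<in> proj_planes. R \<notin> points_on \<rho>}"
        using graph_plane_in_proj_planes[of m] r_notin_graph_plane[of m] mem_points_on_span[of \<rho> r] r
        by (auto simp: proj_subspaces_def)
    qed
    then have "cone_circles R \<Q> = (\<lambda>\<rho>. points_on \<rho> \<inter> \<Q>) ` range graph_plane"
      unfolding cone_circles_def by blast
    then show ?thesis by (simp add: image_image circle)
  qed
  ultimately have "arc K \<and> card K = CARD('a) + 1 \<and> bij_betw ?h (K \<times> UNIV) (\<Q> - {R})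
      \<and> cone_circles R \<Q> = range (\<lambda>m. (\<lambda>p. ?h (p, m \<cdot> p)) ` K)"
    using K by (simp add: bij_betw_def)
  then show ?thesis by blast
qed

text \<open>  The coordinates of the cone are transported along an isomorphism of incidence structures.\<close>

lemma ovoidal_laguerre_plane_coordinates:
  fixes \<P> :: "'p set"
  assumes "ovoidal_laguerre_plane TYPE('a::{field,finite}) q \<P> \<B>"
  shows "\<exists>(K :: ('a ^ 3) set) h. arc K \<and> card K = CARD('a) + 1 \<and> bij_betw h (K \<times> UNIV) \<P>
    \<and> \<B> = range (\<lambda>m. (\<lambda>p. h (p, m \<cdot> p)) ` K)"
proof -
  obtain R :: "('a ^ 4) set" and \<Q> where cone: "oval_cone R \<Q>"
    and iso: "incidence_isomorphic \<P> \<B> (\<Q> - {R}) (cone_circles R \<Q>)"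
    using assms by (auto simp: ovoidal_laguerre_plane_def)
  obtain K :: "('a ^ 3) set" and h where K: "arc K" "card K = CARD('a) + 1"
    and h: "bij_betw h (K \<times> UNIV) (\<Q> - {R})"
    and circles: "cone_circles R \<Q> = range (\<lambda>m. (\<lambda>p. h (p, m \<cdot> p)) ` K)"
    using oval_cone_coordinates[OF cone] by blast
  obtain f where f: "bij_betw f \<P> (\<Q> - {R})" and fB: "(\<lambda>c. f ` c) ` \<B> = cone_circles R \<Q>"
    and BP: "\<B> \<subseteq> Pow \<P>"
    using iso by (auto simp: incidence_isomorphic_def)
  let ?g = "inv_into \<P> f"
  have "(\<lambda>c. ?g ` c) ` ((\<lambda>c. f ` c) ` \<B>) = \<B>"
  proof -
    have "?g ` (f ` c) = c" if "c \<in> \<B>" for c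
      using inv_into_image_cancel[OF bij_betw_imp_inj_on[OF f], of c] BP that by auto
    then show ?thesis by (simp add: image_image)
  qed
  then have "\<B> = range (\<lambda>m. (\<lambda>p. (?g \<circ> h) (p, m \<cdot> p)) ` K)"
    unfolding fB circles by (simp add: image_image)
  moreover have "bij_betw (?g \<circ> h) (K \<times> UNIV) \<P>"
    by (rule bij_betw_trans[OF h bij_betw_inv_into[OF f]])
  ultimately show ?thesis using K by blast
qed

section \<open>Intersecting families of circles\<close>

theorem theorem1p4:
  fixes q :: nat and \<P> :: "'p set" and \<B> \<F> :: "'p set set"
  assumes "primepow q" and "odd q"
    and "ovoidal_laguerre_plane TYPE('a::{field,finite}) q \<P> \<B>"
    and "\<F> \<subseteq> \<B>" and "intersecting_family \<F>"
  shows "card \<F> \<le> q\<^sup>2 \<and> (card \<F> = q\<^sup>2 \<longleftrightarrow> (\<exists>P\<in>\<P>. \<F> = {c \<in> \<B>. P \<in> c}))"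
proof -
  have q: "CARD('a) = q" using assms(3) by (simp add: ovoidal_laguerre_plane_def)
  obtain K :: "('a ^ 3) set" and h where arc: "arc K" and card_K: "card K = CARD('a) + 1"
    and h: "bij_betw h (K \<times> UNIV) \<P>" and \<B>: "\<B> = range (\<lambda>m. (\<lambda>p. h (p, m \<cdot> p)) ` K)"
    using ovoidal_laguerre_plane_coordinates[OF assms(3)] by blast
  interpret odd_oval K
    using arc card_K assms(2) q by unfold_locales auto
  \<comment> \<open>The circle with equation \<open>m\<close>; three points of it already determine \<open>m\<close>.\<close>
  define circle where "circle m = (\<lambda>p. h (p, m \<cdot> p)) ` K" for m
  have incident: "h (p, a) \<in> circle m \<longleftrightarrow> m \<cdot> p = a" if "p \<in> K" for p a m
    using that bij_betw_imp_inj_on[OF h] by (auto simp: circle_def dest: inj_onD)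
  have circle_eqD: "m \<cdot> p = m' \<cdot> p" if "circle m = circle m'" "p \<in> K" for m m' p
    using incident[OF that(2)] that(1) by metis
  have "inj circle"
  proof (rule injI)
    fix m m' assume eq: "circle m = circle m'"
    obtain p where p: "p \<in> K" using card_K_ge_3 by fastforce
    obtain r where r: "r \<in> K" "r \<noteq> p" using ex_third[OF card_K_ge_3, of p p] by blast
    obtain t where t: "t \<in> K" "t \<noteq> p" "t \<noteq> r" using ex_third[OF card_K_ge_3, of p r] by blast
    have "m - m' = 0"
      using arc_eq_0_if_three_zeros[OF arc p r(1) t(1), of "m - m'"] r t circle_eqD[OF eq] p
      by (simp add: dot_simps)
    then show "m = m'" by simp
  qed
  define F where "F = {m. circle m \<in> \<F>}"
  have \<F>: "\<F> = circle ` F"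
    using assms(4) by (auto simp: F_def \<B> circle_def)
  have card_F: "card \<F> = card F"
    unfolding \<F> by (rule card_image) (rule inj_on_subset[OF \<open>inj circle\<close>], simp)
  have agr: "pairwise_agreeing F"
    unfolding pairwise_agreeing_def
  proof (intro ballI)
    fix x y assume "x \<in> F" "y \<in> F"
    then have "circle x \<inter> circle y \<noteq> {}"
      using assms(5) by (simp add: intersecting_family_def F_def)
    then obtain p where "p \<in> K" "h (p, x \<cdot> p) \<in> circle y" by (auto simp: circle_def)
    then show "\<exists>p\<in>K. x \<cdot> p = y \<cdot> p" using incident by metis
  qed
  have pencil: "\<F> = {c \<in> \<B>. h (p, a) \<in> c} \<longleftrightarrow> F = {x. x \<cdot> p = a}" if "p \<in> K" for p a
  proof -
    have "{c \<in> \<B>. h (p, a) \<in> c} = circle ` {x. x \<cdot> p = a}"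
      using incident[OF that] by (auto simp: \<B> circle_def[symmetric])
    then show ?thesis unfolding \<F> by (simp add: inj_image_eq_iff[OF \<open>inj circle\<close>])
  qed
  have "card F = q\<^sup>2 \<longleftrightarrow> (\<exists>p\<in>K. \<exists>a. F = {x. x \<cdot> p = a})"
  proof
    assume "card F = q\<^sup>2"
    then show "\<exists>p\<in>K. \<exists>a. F = {x. x \<cdot> p = a}" using ex_full_section[OF agr] q by simp
  next
    assume "\<exists>p\<in>K. \<exists>a. F = {x. x \<cdot> p = a}"
    then obtain p a where "p \<in> K" "F = {x. x \<cdot> p = a}" by blast
    then show "card F = q\<^sup>2"
      using card_hyperplane[OF arc_neq_0[OF arc card_K_ge_3], of p a] q by (simp add: dot_commute[of _ p])
  qed
  also have "\<dots> \<longleftrightarrow> (\<exists>p\<in>K. \<exists>a. \<F> = {c \<in> \<B>. h (p, a) \<in> c})"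
    by (intro bex_cong refl) (simp only: pencil)
  also have "\<dots> \<longleftrightarrow> (\<exists>P\<in>h ` (K \<times> UNIV). \<F> = {c \<in> \<B>. P \<in> c})"
    by auto
  also have "h ` (K \<times> UNIV) = \<P>"
    using h by (rule bij_betw_imp_surj_on)
  finally show ?thesis
    using card_pairwise_agreeing_le[OF agr] card_F q by simp
qed

end
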